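(* Let $(M,g)$ be a Riemannian manifold, let $R:TM\to M$ be a retraction on $M$, and let $f:M\to\mathbb{R}$ be a smooth function that is bounded below and has the following property: there exists $L>0$ such that $$|\mathrm{D}(f\circ R_x)(t\eta)[\eta]-\mathrm{D}(f\circ R_x)(0_x)[\eta]|\le Lt\qquad\text{for all } x\in M,\ \eta\in T_xM \text{ with } \|\eta\|_x=1,\ t\ge 0 .$$ Let $0<c_1<c_2<1$ and $\sigma:=(1-c_2)/(1+c_2)$. Let $\{x_k\}_{k\ge 0}\subset M$ be any sequence generated from a point $x_0\in M$ by the Riemannian conjugate gradient method $$\eta_0=-\operatorname{grad}f(x_0),\qquad x_{k+1}=R_{x_k}(\alpha_k\eta_k),\qquad \eta_{k+1}=-\operatorname{grad}f(x_{k+1})+\beta_{k+1}\mathcal{T}^{(k)}_{\alpha_k\eta_k}(\eta_k)\qquad(k\ge 0),$$ where $\mathcal{T}^{(k)}$ is the scaled vector transport associated with the differentiated retraction (defined in the context). Suppose that each step size $\alpha_k>0$ satisfies the strong Wolfe conditions $$f(R_{x_k}(\alpha_k\eta_k))\le f(x_k)+c_1\alpha_k\langle\operatorname{grad}f(x_k),\eta_k\rangle_{x_k},$$ $$\left|\langle\operatorname{grad}f(R_{x_k}(\alpha_k\eta_k)),\mathrm{D}R_{x_k}(\alpha_k\eta_k)[\eta_k]\rangle_{R_{x_k}(\alpha_k\eta_k)}\right|\le c_2\left|\langle\operatorname{grad}f(x_k),\eta_k\rangle_{x_k}\right|,$$ and that the real parameters $\beta_k$ ($k\ge 1$) are such that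 the ratio $r_k:=\beta_k/\beta_k^{\mathrm{DY}}$ satisfies $-\sigma\le r_k\le 1$, where $\beta_k^{\mathrm{DY}}$ is the Riemannian Dai-Yuan parameter (defined in the context). Then $$\liminf_{k\to\infty}\|\operatorname{grad}f(x_k)\|_{x_k}=0 .$$
   Context: Notation: $\langle\cdot,\cdot\rangle_x$ is the Riemannian metric $g$ on the tangent space $T_xM$, $\|\cdot\|_x$ is the induced norm, and $\operatorname{grad}f(x)\in T_xM$ is the Riemannian gradient, i.e. $df_x(\xi)=\langle\operatorname{grad}f(x),\xi\rangle_x$ for all $\xi\in T_xM$. $\mathrm{D}$ denotes the differential of a map. Retraction: a smooth map $R:TM\to M$ such that, with $R_x$ denoting the restriction of $R$ to $T_xM$ (and $0_x$ the zero element of $T_xM$), one has $R_x(0_x)=x$ and, under the canonical identification $T_{0_x}T_xM\simeq T_xM$, $\mathrm{D}R_x(0_x)[\xi]=\xi$ for all $\xi\in T_xM$. Differentiated retraction: for $x\in M$ and $\eta,\xi\in T_xM$, $\mathcal{T}^R_\eta(\xi):=\mathrm{D}R_x(\eta)[\xi]\in T_{R_x(\eta)}M$. Scaled vector transport at iteration $k$ (with $x_{k+1}=R_{x_k}(\alpha_k\eta_k)$): $$\mathcal{T}^{(k)}_{\alpha_k\eta_k}(\eta_k):=\begin{cases}\mathcal{T}^R_{\alpha_k\eta_k}(\eta_k), & \text{if } \|\mathcal{T}^R_{\alpha_k\eta_k}(\eta_k)\|_{x_{k+1}}\le\|\eta_k\|_{x_k},\\[4pt] \dfrac{\|\eta_k\|_{x_k}}{\|\mathcal{T}^R_{\alpha_k\eta_k}(\eta_k)\|_{x_{k+1}}}\,\mathcal{T}^R_{\alpha_k\eta_k}(\eta_k),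 & \text{otherwise.}\end{cases}$$ Riemannian Dai-Yuan parameter: for $k\ge 1$, $$\beta_k^{\mathrm{DY}}=\frac{\|\operatorname{grad}f(x_k)\|_{x_k}^2}{\langle\operatorname{grad}f(x_k),\mathcal{T}^{(k-1)}_{\alpha_{k-1}\eta_{k-1}}(\eta_{k-1})\rangle_{x_k}-\langle\operatorname{grad}f(x_{k-1}),\eta_{k-1}\rangle_{x_{k-1}}}.$$ Convention: if $\operatorname{grad}f(x_{k_0})=0$ for some $k_0$, the method is regarded as having stopped at $x_{k_0}$ (that is, $x_k=x_{k_0}$ for all $k\ge k_0$), and the conclusion holds trivially; the ratio condition is imposed only while the gradients are nonzero. *)

theory Defs
  imports "HOL-Analysis.Analysis" "HOL-Library.Function_Algebras"
begin

section \<open>Smooth manifolds\<close>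

text \<open>
  On an open subset of a finite-dimensional space, \<open>Ck_on n\<close> is \<open>n\<close>-fold continuous
  differentiability, phrased through directional derivatives.
\<close>

primrec Ck_on ::
  "nat \<Rightarrow> ('a::real_normed_vector \<Rightarrow> 'b::real_normed_vector) \<Rightarrow> 'a set \<Rightarrow> bool" where
  "Ck_on 0 f S \<longleftrightarrow> continuous_on S f"
| "Ck_on (Suc n) f S \<longleftrightarrow>
     (\<forall>x\<in>S. f differentiable (at x)) \<and>
     (\<forall>v. Ck_on n (\<lambda>x. frechet_derivative f (at x) v) S)"

definition smooth_on ::
  "'a::real_normed_vector set \<Rightarrow> ('a \<Rightarrow> 'b::real_normed_vector) \<Rightarrow> bool" where
  "smooth_on S f \<longleftrightarrow> (\<forall>n. Ck_on n f S)"

text \<open>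
  A chart \<open>(U, \<phi>)\<close> consists of its domain and a coordinate map whose values outside
  \<open>U\<close> are irrelevant.
\<close>

type_synonym ('m, 'e) chart = "'m set \<times> ('m \<Rightarrow> 'e)"

definition chart_inv :: "('m, 'e) chart \<Rightarrow> 'e \<Rightarrow> 'm" where
  "chart_inv c = inv_into (fst c) (snd c)"

text \<open>
  The manifold is the whole (Hausdorff, second countable) type \<open>'m\<close>. The model space \<open>'e\<close> is an
  arbitrary finite-dimensional normed space rather than a type of class \<open>euclidean_space\<close>,
  because the latter class has no zero-dimensional instances.
\<close>

definition smooth_manifold ::
  "('m::{t2_space,second_countable_topology}, 'e::real_normed_vector) chart set \<Rightarrow> bool" where
  "smooth_manifold A \<longleftrightarrow>
     (\<exists>B :: 'e set. finite B \<and> span B = UNIV) \<and>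
     (\<Union>c\<in>A. fst c) = UNIV \<and>
     (\<forall>c\<in>A. open (fst c) \<and> open (snd c ` fst c) \<and>
        homeomorphism (fst c) (snd c ` fst c) (snd c) (chart_inv c)) \<and>
     (\<forall>c\<in>A. \<forall>d\<in>A. smooth_on (snd c ` (fst c \<inter> fst d)) (snd d \<circ> chart_inv c))"

text \<open>
  Smooth maps between spaces with atlases \<open>A\<close> and \<open>B\<close>. Openness of all the sets
  \<open>W\<close> is continuity of \<open>h\<close>; stating it this way avoids equipping the total space of the
  tangent bundle with a topology separately from its atlas.
\<close>

definition smooth_map ::
  "('m, 'e::real_normed_vector) chart set \<Rightarrow> ('n, 'f::real_normed_vector) chart set
    \<Rightarrow> ('m \<Rightarrow> 'n) \<Rightarrow> bool" where
  "smooth_map A B h \<longleftrightarrow>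
     (\<forall>c\<in>A. \<forall>d\<in>B. let W = snd c ` (fst c \<inter> h -` fst d) in
        open W \<and> smooth_on W (snd d \<circ> h \<circ> chart_inv c))"

definition smooth_function :: "('m, 'e::real_normed_vector) chart set \<Rightarrow> ('m \<Rightarrow> real) \<Rightarrow> bool" where
  "smooth_function A f \<longleftrightarrow> smooth_map A {(UNIV, id)} f"


section \<open>Tangent vectors\<close>

text \<open>
  A tangent vector at \<open>x\<close> is the family of its coordinate vectors in all the charts of the atlas
  around \<open>x\<close>, related by the derivatives of the transition maps; it is extended by zero to
  everything else, so that equality of tangent vectors is equality of functions. The vector space
  operations on families are pointwise.
\<close>

instantiation "fun" :: (type, real_vector) real_vector
begin

definition scaleR_fun :: "real \<Rightarrow> ('a \<Rightarrow> 'b) \<Rightarrow> 'a \<Rightarrow> 'b" where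
  "scaleR_fun a f = (\<lambda>x. a *\<^sub>R f x)"

instance
  by standard (simp_all add: scaleR_fun_def fun_eq_iff scaleR_add_right scaleR_add_left)

end

type_synonym ('m, 'e) tangent = "('m, 'e) chart \<Rightarrow> 'e"

definition tangent_space ::
  "('m, 'e::real_normed_vector) chart set \<Rightarrow> 'm \<Rightarrow> ('m, 'e) tangent set" where
  "tangent_space A x = {v.
     (\<forall>c. \<not> (c \<in> A \<and> x \<in> fst c) \<longrightarrow> v c = 0) \<and>
     (\<forall>c\<in>A. \<forall>d\<in>A. x \<in> fst c \<and> x \<in> fst d \<longrightarrow>
        v d = frechet_derivative (snd d \<circ> chart_inv c) (at (snd c x)) (v c))}"

text \<open>The tangent vector at \<open>x\<close> whose coordinate vector in the chart \<open>c\<close> is \<open>e\<close>.\<close>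

definition tangent_of ::
  "('m, 'e::real_normed_vector) chart set \<Rightarrow> ('m, 'e) chart \<Rightarrow> 'm \<Rightarrow> 'e \<Rightarrow> ('m, 'e) tangent" where
  "tangent_of A c x e = (\<lambda>d. if d \<in> A \<and> x \<in> fst d
     then frechet_derivative (snd d \<circ> chart_inv c) (at (snd c x)) e else 0)"

definition tangent_bundle_atlas ::
  "('m, 'e::real_normed_vector) chart set \<Rightarrow> ('m \<times> ('m, 'e) tangent, 'e \<times> 'e) chart set" where
  "tangent_bundle_atlas A =
     (\<lambda>c. ({(x, v). x \<in> fst c \<and> v \<in> tangent_space A x}, \<lambda>(x, v). (snd c x, v c))) ` A"

definition chart_at :: "('m, 'e) chart set \<Rightarrow> 'm \<Rightarrow> ('m, 'e) chart" where
  "chart_at A x = (SOME c. c \<in> A \<and> x \<in> fst c)"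

text \<open>The differential \<open>df\<^sub>x(\<xi>)\<close>; for smooth \<open>f\<close> it does not depend on the chosen chart.\<close>

definition differential ::
  "('m, 'e::real_normed_vector) chart set \<Rightarrow> ('m \<Rightarrow> real) \<Rightarrow> 'm \<Rightarrow> ('m, 'e) tangent \<Rightarrow> real" where
  "differential A f x \<xi> = (let c = chart_at A x in
     frechet_derivative (f \<circ> chart_inv c) (at (snd c x)) (\<xi> c))"

text \<open>
  The derivative \<open>Dh(\<eta>)[\<xi>]\<close> of a map \<open>h\<close> defined on the vector space \<open>T\<^sub>xM\<close>, with
  the tangent spaces of \<open>T\<^sub>xM\<close> identified with \<open>T\<^sub>xM\<close>. It is computed in the linear
  coordinates on \<open>T\<^sub>xM\<close> given by a chart around \<open>x\<close>, the choice of which does not matter.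
\<close>

definition fiber_derivative ::
  "('m, 'e::real_normed_vector) chart set \<Rightarrow> 'm \<Rightarrow> (('m, 'e) tangent \<Rightarrow> 'b::real_normed_vector)
    \<Rightarrow> ('m, 'e) tangent \<Rightarrow> ('m, 'e) tangent \<Rightarrow> 'b" where
  "fiber_derivative A x h \<eta> \<xi> = (let c = chart_at A x in
     frechet_derivative (\<lambda>e. h (tangent_of A c x e)) (at (\<eta> c)) (\<xi> c))"


section \<open>Riemannian metrics\<close>

definition riemannian_manifold ::
  "('m::{t2_space,second_countable_topology}, 'e::real_normed_vector) chart set
    \<Rightarrow> ('m \<Rightarrow> ('m, 'e) tangent \<Rightarrow> ('m, 'e) tangent \<Rightarrow> real) \<Rightarrow> bool" where
  "riemannian_manifold A g \<longleftrightarrow>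
     smooth_manifold A \<and>
     (\<forall>x. \<forall>u\<in>tangent_space A x. \<forall>v\<in>tangent_space A x. g x u v = g x v u) \<and>
     (\<forall>x. \<forall>u\<in>tangent_space A x. \<forall>v\<in>tangent_space A x. \<forall>w\<in>tangent_space A x. \<forall>a b.
        g x (a *\<^sub>R u + b *\<^sub>R v) w = a * g x u w + b * g x v w) \<and>
     (\<forall>x. \<forall>u\<in>tangent_space A x. u \<noteq> 0 \<longrightarrow> g x u u > 0) \<and>
     (\<forall>c\<in>A. \<forall>e e'. smooth_on (snd c ` fst c)
        (\<lambda>p. let x = chart_inv c p in g x (tangent_of A c x e) (tangent_of A c x e')))"

definition metric_norm ::
  "('m \<Rightarrow> ('m, 'e) tangent \<Rightarrow> ('m, 'e) tangent \<Rightarrow> real) \<Rightarrow> 'm \<Rightarrow> ('m, 'e) tangent \<Rightarrow> real" where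
  "metric_norm g x v = sqrt (g x v v)"

definition grad ::
  "('m, 'e::real_normed_vector) chart set \<Rightarrow> ('m \<Rightarrow> ('m, 'e) tangent \<Rightarrow> ('m, 'e) tangent \<Rightarrow> real)
    \<Rightarrow> ('m \<Rightarrow> real) \<Rightarrow> 'm \<Rightarrow> ('m, 'e) tangent" where
  "grad A g f x = (THE v. v \<in> tangent_space A x \<and>
     (\<forall>\<xi>\<in>tangent_space A x. differential A f x \<xi> = g x v \<xi>))"


section \<open>Retractions and vector transport\<close>

text \<open>The tangent vector \<open>DR\<^sub>x(\<eta>)[\<xi>]\<close> at \<open>R\<^sub>x(\<eta>)\<close>, given by its coordinates.\<close>

definition diff_retraction ::
  "('m, 'e::real_normed_vector) chart set \<Rightarrow> ('m \<times> ('m, 'e) tangent \<Rightarrow> 'm)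
    \<Rightarrow> 'm \<Rightarrow> ('m, 'e) tangent \<Rightarrow> ('m, 'e) tangent \<Rightarrow> ('m, 'e) tangent" where
  "diff_retraction A R x \<eta> \<xi> = (\<lambda>d. if d \<in> A \<and> R (x, \<eta>) \<in> fst d
     then fiber_derivative A x (\<lambda>v. snd d (R (x, v))) \<eta> \<xi> else 0)"

definition manifold_retraction ::
  "('m, 'e::real_normed_vector) chart set \<Rightarrow> ('m \<times> ('m, 'e) tangent \<Rightarrow> 'm) \<Rightarrow> bool" where
  "manifold_retraction A R \<longleftrightarrow>
     smooth_map (tangent_bundle_atlas A) A R \<and>
     (\<forall>x. R (x, 0) = x) \<and>
     (\<forall>x. \<forall>\<xi>\<in>tangent_space A x. diff_retraction A R x 0 \<xi> = \<xi>)"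

text \<open>The scaled transport of \<open>\<eta>\<close> along \<open>\<alpha>\<eta>\<close>, from \<open>x\<close> to \<open>R\<^sub>x(\<alpha>\<eta>)\<close>.\<close>

definition scaled_transport ::
  "('m, 'e::real_normed_vector) chart set \<Rightarrow> ('m \<Rightarrow> ('m, 'e) tangent \<Rightarrow> ('m, 'e) tangent \<Rightarrow> real)
    \<Rightarrow> ('m \<times> ('m, 'e) tangent \<Rightarrow> 'm) \<Rightarrow> 'm \<Rightarrow> real \<Rightarrow> ('m, 'e) tangent \<Rightarrow> ('m, 'e) tangent" where
  "scaled_transport A g R x \<alpha> \<eta> =
     (let y = R (x, \<alpha> *\<^sub>R \<eta>); v = diff_retraction A R x (\<alpha> *\<^sub>R \<eta>) \<eta> in
      if metric_norm g y v \<le> metric_norm g x \<eta> then v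
      else (metric_norm g x \<eta> / metric_norm g y v) *\<^sub>R v)"

text \<open>Only meaningful for \<open>k \<ge> 1\<close>.\<close>

definition beta_DY ::
  "('m, 'e::real_normed_vector) chart set \<Rightarrow> ('m \<Rightarrow> ('m, 'e) tangent \<Rightarrow> ('m, 'e) tangent \<Rightarrow> real)
    \<Rightarrow> ('m \<times> ('m, 'e) tangent \<Rightarrow> 'm) \<Rightarrow> ('m \<Rightarrow> real)
    \<Rightarrow> (nat \<Rightarrow> 'm) \<Rightarrow> (nat \<Rightarrow> real) \<Rightarrow> (nat \<Rightarrow> ('m, 'e) tangent) \<Rightarrow> nat \<Rightarrow> real" where
  "beta_DY A g R f x \<alpha> \<eta> k =
     (metric_norm g (x k) (grad A g f (x k)))\<^sup>2 /
     (g (x k) (grad A g f (x k)) (scaled_transport A g R (x (k - 1)) (\<alpha> (k - 1)) (\<eta> (k - 1)))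
      - g (x (k - 1)) (grad A g f (x (k - 1))) (\<eta> (k - 1)))"

end

theory Submission
  imports Defs
begin

text \<open>
  Write \<open>d\<^sub>k\<close> for the gradient at \<open>x\<^sub>k\<close>, \<open>G\<^sub>k\<close> and \<open>N\<^sub>k\<close> for the squared norms of
  \<open>d\<^sub>k\<close> and \<open>\<eta>\<^sub>k\<close>, \<open>m\<^sub>k\<close> for the slope \<open>\<langle>d\<^sub>k, \<eta>\<^sub>k\<rangle>\<close>, \<open>T\<^sub>k\<close> for the scaled
  transport of \<open>\<eta>\<^sub>k\<close> to \<open>x\<^sub>k\<^sub>+\<^sub>1\<close>, and \<open>s\<^sub>k = \<langle>d\<^sub>k\<^sub>+\<^sub>1, T\<^sub>k\<rangle>\<close>. The theorem rests on two
  opposite bounds for the sequence \<open>a\<^sub>k = N\<^sub>k / m\<^sub>k\<^sup>2\<close>. It is the reciprocal of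
  \<open>G\<^sub>k cos\<^sup>2 \<theta>\<^sub>k\<close>, where \<open>\<theta>\<^sub>k\<close> is the angle between \<open>\<eta>\<^sub>k\<close> and steepest descent.

  On the one hand, the line search forces a decrease of \<open>f\<close> by a fixed multiple of \<open>1 / a\<^sub>k\<close>
  in every step (\<open>wolfe_decrease\<close>): the curvature condition says that the slope along the
  curve has changed by at least \<open>(1 - c\<^sub>2) \<bar>m\<^sub>k\<bar>\<close>, the Lipschitz property turns this into a lower
  bound for the step size, and the sufficient decrease condition turns that into a decrease of
  \<open>f\<close>. As \<open>f\<close> is bounded below, the sum of all \<open>1 / a\<^sub>k\<close> is finite; this is Zoutendijk's
  condition.

  On the other hand, the scaling makes \<open>T\<^sub>k\<close> no longer than \<open>\<eta>\<^sub>k\<close>, and the admissible range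
  of the ratio \<open>r\<^sub>k\<close> is chosen so that every direction is a descent direction and
  \<open>\<bar>\<beta>\<^sub>k\<^sub>+\<^sub>1 m\<^sub>k\<bar> \<le> \<bar>m\<^sub>k\<^sub>+\<^sub>1\<bar>\<close> (\<open>dai_yuan_ratio_step\<close>). Expanding the square of
  \<open>\<beta>\<^sub>k\<^sub>+\<^sub>1 T\<^sub>k = \<eta>\<^sub>k\<^sub>+\<^sub>1 + d\<^sub>k\<^sub>+\<^sub>1\<close> then gives \<open>a\<^sub>k\<^sub>+\<^sub>1 \<le> a\<^sub>k + 1 / G\<^sub>k\<^sub>+\<^sub>1\<close>
  (\<open>inverse_square_cosine_step\<close>). If the gradients stayed away from zero, \<open>a\<^sub>k\<close> would grow at most
  linearly and the sum of all \<open>1 / a\<^sub>k\<close> would diverge with the harmonic series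
  (\<open>linear_growth_contradicts_bounded_decrease\<close>).

  The geometric input is the identification of the derivative of \<open>f\<close> along the retraction
  with \<open>\<langle>grad f(R\<^sub>y(\<eta>)), DR\<^sub>y(\<eta>)[\<xi>]\<rangle>\<close> (\<open>fiber_derivative_eq_grad\<close>). It comes down to the
  chain rule in charts and to the existence of the gradient, which is the Riesz representation of
  a linear form in finite dimension.
\<close>


section \<open>Tangent vectors in coordinates\<close>

lemma smooth_on_imp_differentiable:
  assumes "smooth_on S f" "p \<in> S"
  shows "f differentiable (at p)"
proof -
  have "Ck_on (Suc 0) f S" using assms(1) unfolding smooth_on_def by blast
  then show ?thesis using assms(2) by simp
qed

lemma chart_inv_apply:
  assumes "smooth_manifold A" "c \<in> A" "x \<in> fst c"
  shows "chart_inv c (snd c x) = x"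
  using assms unfolding smooth_manifold_def homeomorphism_def by blast

lemma apply_chart_inv:
  assumes "smooth_manifold A" "c \<in> A" "p \<in> snd c ` fst c"
  shows "snd c (chart_inv c p) = p" "chart_inv c p \<in> fst c"
  using assms unfolding smooth_manifold_def homeomorphism_def by blast+

lemma open_chart_preimage:
  assumes "smooth_manifold A" "c \<in> A" "open U"
  shows "open (snd c ` fst c \<inter> chart_inv c -` U)"
proof -
  have "open (snd c ` fst c)" "continuous_on (snd c ` fst c) (chart_inv c)"
    using assms unfolding smooth_manifold_def homeomorphism_def by blast+
  then show ?thesis using assms(3) by (auto intro: continuous_open_preimage)
qed

lemma chart_at_mem:
  assumes "smooth_manifold A"
  shows "chart_at A x \<in> A" "x \<in> fst (chart_at A x)"
proof -
  have "\<exists>c. c \<in> A \<and> x \<in> fst c" using assms unfolding smooth_manifold_def by blast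
  from someI_ex[OF this] show "chart_at A x \<in> A" "x \<in> fst (chart_at A x)"
    unfolding chart_at_def by auto
qed

lemma transition_differentiable:
  assumes "smooth_manifold A" "c \<in> A" "d \<in> A" "x \<in> fst c" "x \<in> fst d"
  shows "(snd d \<circ> chart_inv c) differentiable (at (snd c x))"
proof (rule smooth_on_imp_differentiable)
  show "smooth_on (snd c ` (fst c \<inter> fst d)) (snd d \<circ> chart_inv c)"
    using assms unfolding smooth_manifold_def by blast
qed (use assms in auto)

text \<open>
  The chain rule for \<open>h \<circ> \<gamma>\<close> through the chart \<open>d\<close>, where the map \<open>\<gamma>\<close> into the manifold
  is arbitrary: taking for it the inverse of another chart relates coordinates of tangent vectors,
  taking a retraction restricted to one fibre differentiates along that retraction.
\<close>

lemma frechet_derivative_through_chart: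
  assumes mfd: "smooth_manifold A" and d: "d \<in> A"
    and S: "open S" "p \<in> S" "\<And>q. q \<in> S \<Longrightarrow> \<gamma> q \<in> fst d"
    and \<gamma>: "(\<lambda>q. snd d (\<gamma> q)) differentiable (at p)"
    and h: "(h \<circ> chart_inv d) differentiable (at (snd d (\<gamma> p)))"
  shows "frechet_derivative (\<lambda>q. h (\<gamma> q)) (at p) v =
    frechet_derivative (h \<circ> chart_inv d) (at (snd d (\<gamma> p)))
      (frechet_derivative (\<lambda>q. snd d (\<gamma> q)) (at p) v)"
proof -
  let ?D\<gamma> = "frechet_derivative (\<lambda>q. snd d (\<gamma> q)) (at p)"
  let ?Dh = "frechet_derivative (h \<circ> chart_inv d) (at (snd d (\<gamma> p)))"
  have "((h \<circ> chart_inv d) \<circ> (\<lambda>q. snd d (\<gamma> q)) has_derivative ?Dh \<circ> ?D\<gamma>) (at p)"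
    using \<gamma> h by (intro diff_chain_at) (simp_all add: frechet_derivative_works[symmetric])
  then have "((\<lambda>q. h (\<gamma> q)) has_derivative ?Dh \<circ> ?D\<gamma>) (at p)"
    by (rule has_derivative_transform_within_open[OF _ S(1,2)])
      (simp add: chart_inv_apply[OF mfd d] S(3))
  from frechet_derivative_at[OF this] show ?thesis
    by (metis comp_apply)
qed

lemma tangent_of_coord:
  assumes "smooth_manifold A" "c \<in> A" "x \<in> fst c"
  shows "tangent_of A c x e c = e"
proof -
  have "((\<lambda>p. p) has_derivative (\<lambda>v. v)) (at (snd c x))" by (rule has_derivative_ident)
  then have "((snd c \<circ> chart_inv c) has_derivative (\<lambda>v. v)) (at (snd c x))"
  proof (rule has_derivative_transform_within_open)
    show "open (snd c ` fst c)" using assms unfolding smooth_manifold_def by blast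
  qed (use assms apply_chart_inv[OF assms(1,2)] in auto)
  then have "frechet_derivative (snd c \<circ> chart_inv c) (at (snd c x)) = (\<lambda>v. v)"
    by (rule frechet_derivative_at[symmetric])
  then show ?thesis using assms(2,3) by (simp add: tangent_of_def)
qed

text \<open>
  The compatibility required of the coordinates in two charts \<open>d\<close> and \<open>d'\<close> is the chain rule for
  the transition from \<open>c\<close> to \<open>d'\<close> factored through \<open>d\<close>.
\<close>

lemma tangent_of_mem:
  assumes mfd: "smooth_manifold A" and c: "c \<in> A" and x: "x \<in> fst c"
  shows "tangent_of A c x e \<in> tangent_space A x"
proof -
  have "tangent_of A c x e d' =
      frechet_derivative (snd d' \<circ> chart_inv d) (at (snd d x)) (tangent_of A c x e d)"
    if d: "d \<in> A" "d' \<in> A" "x \<in> fst d" "x \<in> fst d'" for d d'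
  proof -
    have "open (fst d)" using mfd d unfolding smooth_manifold_def by blast
    note S = open_chart_preimage[OF mfd c this]
    have "frechet_derivative (\<lambda>p. snd d' (chart_inv c p)) (at (snd c x)) e =
        frechet_derivative (snd d' \<circ> chart_inv d) (at (snd d (chart_inv c (snd c x))))
          (frechet_derivative (\<lambda>p. snd d (chart_inv c p)) (at (snd c x)) e)"
      by (rule frechet_derivative_through_chart[OF mfd d(1) S])
        (use transition_differentiable[OF mfd c d(1) x d(3)]
             transition_differentiable[OF mfd d(1,2,3,4)] d x chart_inv_apply[OF mfd c x]
          in \<open>auto simp: comp_def\<close>)
    then show ?thesis using d chart_inv_apply[OF mfd c x] by (simp add: tangent_of_def comp_def)
  qed
  moreover have "tangent_of A c x e d = 0" if "\<not> (d \<in> A \<and> x \<in> fst d)" for d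
    using that by (auto simp: tangent_of_def)
  ultimately show ?thesis unfolding tangent_space_def by blast
qed

text \<open>
  Together with the two preceding lemmas this makes \<open>tangent_of A c x\<close> a bijection from the model
  space onto the tangent space, so that finite-dimensional linear algebra can be done on the model
  space.
\<close>

lemma tangent_of_coord_inverse:
  assumes "c \<in> A" "x \<in> fst c" "v \<in> tangent_space A x"
  shows "tangent_of A c x (v c) = v"
proof
  fix d
  show "tangent_of A c x (v c) d = v d"
  proof (cases "d \<in> A \<and> x \<in> fst d")
    case True
    then have "v d = frechet_derivative (snd d \<circ> chart_inv c) (at (snd c x)) (v c)"
      using assms unfolding tangent_space_def by blast
    then show ?thesis using True by (simp only: tangent_of_def simp_thms if_True)
  next
    case False
    then have "v d = 0" using assms(3) unfolding tangent_space_def by blast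
    then show ?thesis using False by (simp only: tangent_of_def if_False)
  qed
qed

lemma linear_tangent_of:
  assumes "smooth_manifold A" "c \<in> A" "x \<in> fst c"
  shows "linear (tangent_of A c x)"
proof -
  have "linear (frechet_derivative (snd d \<circ> chart_inv c) (at (snd c x)))"
    if "d \<in> A" "x \<in> fst d" for d
    using transition_differentiable[OF assms(1,2) that(1) assms(3) that(2)]
    by (rule linear_frechet_derivative)
  then show ?thesis
    by (intro linearI) (auto simp: tangent_of_def fun_eq_iff scaleR_fun_def linear_add linear_scale)
qed

lemma subspace_tangent_space:
  assumes "smooth_manifold A"
  shows "subspace (tangent_space A x)"
proof -
  let ?c = "chart_at A x"
  note c = chart_at_mem[OF assms, of x]
  have "tangent_space A x = range (tangent_of A ?c x)"
    using tangent_of_mem[OF assms c] tangent_of_coord_inverse[OF c] by (auto intro: range_eqI sym)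
  then show ?thesis
    using linear_subspace_image[OF linear_tangent_of[OF assms c] subspace_UNIV] by simp
qed


section \<open>The Riemannian gradient\<close>

text \<open>
  Induction over the spanning set. When a vector \<open>a\<close> is added, the induction hypothesis applied to
  the form \<open>b a\<close> yields the orthogonal projection \<open>p\<close> of \<open>a\<close>, and the normal component \<open>a - p\<close>,
  if it is nonzero, can be used to correct the old representative without changing its effect on
  the old span.
\<close>

lemma riesz_representation_on_span:
  fixes b :: "'v::real_vector \<Rightarrow> 'v \<Rightarrow> real"
  assumes b: "bilinear b" and sym: "\<And>u v. b u v = b v u" and pos: "\<And>u. u \<noteq> 0 \<Longrightarrow> b u u > 0"
    and B: "finite B" and \<phi>: "linear \<phi>"
  shows "\<exists>v\<in>span B. \<forall>w\<in>span B. \<phi> w = b v w"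
  using B \<phi>
proof (induction B arbitrary: \<phi> rule: finite_induct)
  case empty
  then show ?case using b by (simp add: linear_0 bilinear_rzero)
next
  case (insert a B)
  obtain v where v: "v \<in> span B" "\<And>w. w \<in> span B \<Longrightarrow> \<phi> w = b v w"
    using insert.IH[OF insert.prems] by blast
  have "linear (b a)" using b by (simp add: bilinear_def)
  then obtain p where p: "p \<in> span B" "\<And>w. w \<in> span B \<Longrightarrow> b a w = b p w"
    using insert.IH by blast
  define n where "n = a - p"
  have orth: "b n w = 0" if "w \<in> span B" for w
    using p(2)[OF that] b by (simp add: n_def bilinear_lsub)
  show ?case
  proof (cases "n = 0")
    case True
    then have "span (insert a B) = span B" using p(1) by (simp add: n_def span_redundant)
    then show ?thesis using v by auto
  next
    case False
    define v' where "v' = v + (\<phi> n / b n n) *\<^sub>R n"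
    have sub: "span B \<subseteq> span (insert a B)" by (simp add: span_mono subset_insertI)
    have n: "n \<in> span (insert a B)"
      unfolding n_def using p(1) sub by (metis insertI1 span_base span_diff subset_iff)
    have "v' \<in> span (insert a B)"
      unfolding v'_def by (intro span_add span_scale n subsetD[OF sub v(1)])
    moreover have "\<phi> w = b v' w" if w_mem: "w \<in> span (insert a B)" for w
    proof -
      obtain k where "w - k *\<^sub>R a \<in> span B" using w_mem unfolding span_breakdown_eq by blast
      then have "w - k *\<^sub>R a + k *\<^sub>R p \<in> span B" using p(1) by (simp add: span_add span_scale)
      then have u: "w - k *\<^sub>R n \<in> span B" by (simp add: n_def algebra_simps)
      define u where "u = w - k *\<^sub>R n"
      have w: "w = u + k *\<^sub>R n" and u: "u \<in> span B" using u by (simp_all add: u_def)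
      have "b v' w = b v u + k * \<phi> n"
        using orth[OF u] orth[OF v(1)] sym[of v n] pos[OF False] b
        by (simp add: v'_def w bilinear_ladd bilinear_radd bilinear_lmul bilinear_rmul)
      then show ?thesis using v(2)[OF u] insert.prems by (simp add: w linear_add linear_scale)
    qed
    ultimately show ?thesis by blast
  qed
qed

lemma metric_positivity:
  assumes "riemannian_manifold A g" and u: "u \<in> tangent_space A x"
  shows metric_pos: "u \<noteq> 0 \<Longrightarrow> 0 < g x u u"
    and metric_nonneg: "0 \<le> g x u u"
    and metric_norm_square: "(metric_norm g x u)\<^sup>2 = g x u u"
proof -
  have lin: "\<And>u v w a b. u \<in> tangent_space A x \<Longrightarrow> v \<in> tangent_space A x \<Longrightarrow>
      w \<in> tangent_space A x \<Longrightarrow> g x (a *\<^sub>R u + b *\<^sub>R v) w = a * g x u w + b * g x v w"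
    using assms(1) unfolding riemannian_manifold_def by blast
  show p: "u \<noteq> 0 \<Longrightarrow> 0 < g x u u"
    using assms unfolding riemannian_manifold_def by blast
  have "g x 0 0 = 0" if "u = 0" using lin[OF u u u, of 0 0] that by simp
  then show nn: "0 \<le> g x u u" using p by (cases "u = 0") auto
  show "(metric_norm g x u)\<^sup>2 = g x u u" using nn by (simp add: metric_norm_def)
qed

lemma metric_bilinear:
  assumes "riemannian_manifold A g"
    and uw: "u \<in> tangent_space A x" "w \<in> tangent_space A x"
  shows metric_commute: "g x u w = g x w u"
    and metric_add_left: "v \<in> tangent_space A x \<Longrightarrow> g x (u + v) w = g x u w + g x v w"
    and metric_scale_left: "g x (a *\<^sub>R u) w = a * g x u w"
    and metric_add_right: "v \<in> tangent_space A x \<Longrightarrow> g x w (u + v) = g x w u + g x w v"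
    and metric_scale_right: "g x w (a *\<^sub>R u) = a * g x w u"
proof -
  have mfd: "smooth_manifold A"
    and sym: "\<And>u v. u \<in> tangent_space A x \<Longrightarrow> v \<in> tangent_space A x \<Longrightarrow> g x u v = g x v u"
    and lin: "\<And>u v w a b. u \<in> tangent_space A x \<Longrightarrow> v \<in> tangent_space A x \<Longrightarrow>
      w \<in> tangent_space A x \<Longrightarrow> g x (a *\<^sub>R u + b *\<^sub>R v) w = a * g x u w + b * g x v w"
    using assms(1) unfolding riemannian_manifold_def by blast+
  note sub = subspace_tangent_space[OF mfd, of x]
  show "g x u w = g x w u" using sym uw by blast
  show add: "g x (u + v) w = g x u w + g x v w" if "v \<in> tangent_space A x"
    using lin[OF uw(1) that uw(2), of 1 1] by simp
  show scale: "g x (a *\<^sub>R u) w = a * g x u w" using lin[OF uw(1,1,2), of a 0] by simp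
  show "g x w (u + v) = g x w u + g x w v" if "v \<in> tangent_space A x"
    using add[OF that] sym[OF uw(2)] uw that subspace_add[OF sub] by simp
  show "g x w (a *\<^sub>R u) = a * g x w u"
    using scale sym[OF uw(2)] uw subspace_scale[OF sub] by simp
qed

lemma smooth_function_differentiable:
  assumes "smooth_function A f" "c \<in> A" "x \<in> fst c"
  shows "(f \<circ> chart_inv c) differentiable (at (snd c x))"
proof (rule smooth_on_imp_differentiable)
  show "smooth_on (snd c ` fst c) (f \<circ> chart_inv c)"
    using assms unfolding smooth_function_def smooth_map_def by (auto simp: Let_def)
qed (use assms in auto)

text \<open>
  The gradient is defined by a definite description, so both its existence (the Riesz
  representation, transported from the model space by \<open>tangent_of\<close>) and its uniqueness (positive
  definiteness) are needed before anything can be said about it.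
\<close>

lemma grad_characterization:
  assumes g: "riemannian_manifold A g" and f: "smooth_function A f"
  shows grad_mem: "grad A g f x \<in> tangent_space A x"
    and differential_eq_grad:
      "\<xi> \<in> tangent_space A x \<Longrightarrow> differential A f x \<xi> = g x (grad A g f x) \<xi>"
proof -
  have mfd: "smooth_manifold A" using g unfolding riemannian_manifold_def by blast
  define c where "c = chart_at A x"
  have c: "c \<in> A" "x \<in> fst c" using chart_at_mem[OF mfd] by (auto simp: c_def)
  define T where "T = tangent_of A c x"
  have T: "T e \<in> tangent_space A x" "linear T" "T e c = e" for e
    using tangent_of_mem[OF mfd c] linear_tangent_of[OF mfd c] tangent_of_coord[OF mfd c]
    by (auto simp: T_def)
  have T_inv: "T (v c) = v" if "v \<in> tangent_space A x" for v
    using tangent_of_coord_inverse[OF c that] by (simp add: T_def)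
  define b where "b = (\<lambda>e e'. g x (T e) (T e'))"
  have "bilinear b"
    unfolding bilinear_def b_def
    by (auto intro!: linearI simp: linear_add[OF T(2)] linear_scale[OF T(2)]
        metric_add_left[OF g] metric_add_right[OF g] metric_scale_left[OF g T(1) T(1)]
        metric_scale_right[OF g T(1) T(1)] T(1))
  moreover have "b u v = b v u" for u v
    unfolding b_def by (rule metric_commute[OF g T(1) T(1)])
  moreover have "b u u > 0" if "u \<noteq> 0" for u
  proof -
    have "T u \<noteq> 0" using that T(3)[of u] by auto
    then show ?thesis unfolding b_def using metric_pos[OF g T(1)] by blast
  qed
  moreover obtain B :: "'b set" where "finite B" and B: "span B = UNIV"
    using mfd unfolding smooth_manifold_def by blast
  moreover have "linear (frechet_derivative (f \<circ> chart_inv c) (at (snd c x)))"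
    by (rule linear_frechet_derivative[OF smooth_function_differentiable[OF f c]])
  ultimately obtain e where
    "\<And>w. frechet_derivative (f \<circ> chart_inv c) (at (snd c x)) w = b e w"
    using riesz_representation_on_span[of b B] by (metis B UNIV_I)
  then have ex: "differential A f x \<xi> = g x (T e) \<xi>" if "\<xi> \<in> tangent_space A x" for \<xi>
    using T_inv[OF that] by (simp add: differential_def Let_def b_def flip: c_def)
  have "\<exists>!v. v \<in> tangent_space A x \<and> (\<forall>\<xi>\<in>tangent_space A x. differential A f x \<xi> = g x v \<xi>)"
  proof (rule ex1I[of _ "T e"])
    show "T e \<in> tangent_space A x \<and> (\<forall>\<xi>\<in>tangent_space A x. differential A f x \<xi> = g x (T e) \<xi>)"
      using ex T(1) by blast
  next
    fix v assume "v \<in> tangent_space A x \<and> (\<forall>\<xi>\<in>tangent_space A x. differential A f x \<xi> = g x v \<xi>)"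
    then have v: "v \<in> tangent_space A x" "\<And>\<xi>. \<xi> \<in> tangent_space A x \<Longrightarrow> g x v \<xi> = g x (T e) \<xi>"
      using ex by auto
    note sub = subspace_tangent_space[OF mfd, of x]
    have neg: "(-1) *\<^sub>R T e \<in> tangent_space A x" using sub T(1) by (rule subspace_scale)
    define w where "w = v + (-1) *\<^sub>R T e"
    have w: "w \<in> tangent_space A x" unfolding w_def using sub v(1) neg by (rule subspace_add)
    have "g x w w = g x v w - g x (T e) w"
      using metric_add_left[OF g v(1) w neg] metric_scale_left[OF g T(1) w, of "-1"]
      by (simp add: w_def)
    then have "w = 0" using v(2)[OF w] metric_pos[OF g w] by (cases "w = 0") auto
    then show "v = T e" by (simp add: w_def)
  qed
  from theI'[OF this]
  show "grad A g f x \<in> tangent_space A x"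
    and "\<xi> \<in> tangent_space A x \<Longrightarrow> differential A f x \<xi> = g x (grad A g f x) \<xi>"
    unfolding grad_def by blast+
qed


section \<open>Differentiating along a retraction\<close>

text \<open>
  Smoothness of the retraction is stated on the tangent bundle. Its bundle chart over \<open>c\<close> restricts
  on the fibre over \<open>y\<close> to the linear coordinates \<open>tangent_of A c y\<close>, so fixing the base
  coordinates gives differentiability in the fibre variable alone.
\<close>

lemma retraction_in_coordinates:
  assumes mfd: "smooth_manifold A" and R: "manifold_retraction A R"
    and c: "c \<in> A" "y \<in> fst c" and d: "d \<in> A"
  defines "S \<equiv> {e. R (y, tangent_of A c y e) \<in> fst d}"
  shows "open S"
    and "e \<in> S \<Longrightarrow> (\<lambda>e. snd d (R (y, tangent_of A c y e))) differentiable (at e)"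
proof -
  define C :: "('a \<times> ('a, 'b) tangent, 'b \<times> 'b) chart"
    where "C = ({(x, v). x \<in> fst c \<and> v \<in> tangent_space A x}, \<lambda>(x, v). (snd c x, v c))"
  define W where "W = snd C ` (fst C \<inter> R -` fst d)"
  have "C \<in> tangent_bundle_atlas A" using c by (auto simp: C_def tangent_bundle_atlas_def)
  then have W: "open W" "smooth_on W (snd d \<circ> R \<circ> chart_inv C)"
    using R d unfolding manifold_retraction_def smooth_map_def W_def by (auto simp: Let_def)
  have inj: "inj_on (snd C) (fst C)"
  proof (rule inj_onI, clarsimp simp: C_def)
    fix x v x' v'
    assume *: "x \<in> fst c" "v \<in> tangent_space A x" "x' \<in> fst c" "v' \<in> tangent_space A x'"
      "snd c x = snd c x'" "v c = v' c"
    have "x = x'" using * chart_inv_apply[OF mfd c(1)] by metis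
    then show "x = x' \<and> v = v'" using * tangent_of_coord_inverse[OF c(1)] by metis
  qed
  have in_C: "(y, tangent_of A c y e) \<in> fst C" for e
    using c tangent_of_mem[OF mfd c] by (simp add: C_def)
  have snd_C: "snd C (y, tangent_of A c y e) = (snd c y, e)" for e
    using tangent_of_coord[OF mfd c] by (simp add: C_def)
  \<comment> \<open>The bundle chart is injective, hence its inverse is determined by this one preimage.\<close>
  have C_inv: "chart_inv C (snd c y, e) = (y, tangent_of A c y e)" for e
    unfolding chart_inv_def using inv_into_f_f[OF inj in_C[of e]] snd_C by simp
  have S: "S = Pair (snd c y) -` W"
  proof (intro set_eqI iffI)
    fix e assume "e \<in> S"
    then have "(y, tangent_of A c y e) \<in> fst C \<inter> R -` fst d" using in_C by (simp add: S_def)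
    from imageI[OF this, of "snd C"] show "e \<in> Pair (snd c y) -` W" by (simp add: snd_C W_def)
  next
    fix e assume "e \<in> Pair (snd c y) -` W"
    then obtain z where "z \<in> fst C" "R z \<in> fst d" "snd C z = (snd c y, e)"
      by (auto simp: W_def)
    moreover have "z = (y, tangent_of A c y e)"
      using inj in_C snd_C calculation by (metis inj_onD)
    ultimately show "e \<in> S" by (simp add: S_def)
  qed
  show "open S" unfolding S by (intro open_vimage W continuous_intros)
  show "(\<lambda>e. snd d (R (y, tangent_of A c y e))) differentiable (at e)" if "e \<in> S"
  proof -
    have "(snd d \<circ> R \<circ> chart_inv C) differentiable (at (snd c y, e))"
      using W(2) that by (auto simp: S intro: smooth_on_imp_differentiable)
    moreover have "Pair (snd c y) differentiable (at e)"
      unfolding differentiable_def by (auto intro!: derivative_eq_intros)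
    ultimately have "((snd d \<circ> R \<circ> chart_inv C) \<circ> Pair (snd c y)) differentiable (at e)"
      by (intro differentiable_chain_at)
    then show ?thesis by (simp add: comp_def C_inv)
  qed
qed

lemma fiber_derivative_retraction:
  assumes mfd: "smooth_manifold A" and R: "manifold_retraction A R"
    and \<eta>: "\<eta> \<in> tangent_space A y" and d: "d \<in> A" "R (y, \<eta>) \<in> fst d"
    and h: "(h \<circ> chart_inv d) differentiable (at (snd d (R (y, \<eta>))))"
  shows "fiber_derivative A y (\<lambda>v. h (R (y, v))) \<eta> \<xi> =
    frechet_derivative (h \<circ> chart_inv d) (at (snd d (R (y, \<eta>)))) (diff_retraction A R y \<eta> \<xi> d)"
proof -
  let ?c = "chart_at A y"
  note c = chart_at_mem[OF mfd, of y]
  note \<eta>_c = tangent_of_coord_inverse[OF c \<eta>]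
  note coords = retraction_in_coordinates[OF mfd R c d(1)]
  have "frechet_derivative (\<lambda>e. h (R (y, tangent_of A ?c y e))) (at (\<eta> ?c)) (\<xi> ?c) =
    frechet_derivative (h \<circ> chart_inv d) (at (snd d (R (y, tangent_of A ?c y (\<eta> ?c)))))
      (frechet_derivative (\<lambda>e. snd d (R (y, tangent_of A ?c y e))) (at (\<eta> ?c)) (\<xi> ?c))"
    by (rule frechet_derivative_through_chart[OF mfd d(1) coords(1)])
      (use coords(2) \<eta>_c d h in auto)
  then show ?thesis using d \<eta>_c by (simp add: fiber_derivative_def diff_retraction_def Let_def)
qed

lemma diff_retraction_mem:
  assumes mfd: "smooth_manifold A" and R: "manifold_retraction A R"
    and \<eta>: "\<eta> \<in> tangent_space A y"
  shows "diff_retraction A R y \<eta> \<xi> \<in> tangent_space A (R (y, \<eta>))"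
proof -
  have "diff_retraction A R y \<eta> \<xi> d' = frechet_derivative (snd d' \<circ> chart_inv d)
      (at (snd d (R (y, \<eta>)))) (diff_retraction A R y \<eta> \<xi> d)"
    if d: "d \<in> A" "d' \<in> A" "R (y, \<eta>) \<in> fst d" "R (y, \<eta>) \<in> fst d'" for d d'
  proof -
    have "diff_retraction A R y \<eta> \<xi> d' = fiber_derivative A y (\<lambda>v. snd d' (R (y, v))) \<eta> \<xi>"
      using d by (simp add: diff_retraction_def)
    also note fiber_derivative_retraction[OF mfd R \<eta> d(1,3) transition_differentiable[OF mfd d]]
    finally show ?thesis .
  qed
  moreover have "diff_retraction A R y \<eta> \<xi> d = 0" if "\<not> (d \<in> A \<and> R (y, \<eta>) \<in> fst d)" for d
    using that by (auto simp: diff_retraction_def)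
  ultimately show ?thesis unfolding tangent_space_def by blast
qed

text \<open>
  This turns the hypothesis on \<open>f \<circ> R\<^sub>y\<close> into a statement about the inner products that
  occur in the Wolfe conditions.
\<close>

lemma fiber_derivative_eq_grad:
  assumes g: "riemannian_manifold A g" and R: "manifold_retraction A R"
    and f: "smooth_function A f" and \<eta>: "\<eta> \<in> tangent_space A y"
  shows "fiber_derivative A y (\<lambda>v. f (R (y, v))) \<eta> \<xi> =
    g (R (y, \<eta>)) (grad A g f (R (y, \<eta>))) (diff_retraction A R y \<eta> \<xi>)"
proof -
  have mfd: "smooth_manifold A" using g unfolding riemannian_manifold_def by blast
  let ?z = "R (y, \<eta>)"
  note d = chart_at_mem[OF mfd, of ?z]
  have "fiber_derivative A y (\<lambda>v. f (R (y, v))) \<eta> \<xi> =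
      differential A f ?z (diff_retraction A R y \<eta> \<xi>)"
    using fiber_derivative_retraction[OF mfd R \<eta> d smooth_function_differentiable[OF f d]]
    by (simp add: differential_def Let_def)
  also have "\<dots> = g ?z (grad A g f ?z) (diff_retraction A R y \<eta> \<xi>)"
    by (rule differential_eq_grad[OF g f diff_retraction_mem[OF mfd R \<eta>]])
  finally show ?thesis .
qed

lemma diff_retraction_scale:
  assumes mfd: "smooth_manifold A" and R: "manifold_retraction A R"
    and \<eta>: "\<eta> \<in> tangent_space A y"
  shows "diff_retraction A R y \<eta> (a *\<^sub>R \<xi>) = a *\<^sub>R diff_retraction A R y \<eta> \<xi>"
proof -
  note c = chart_at_mem[OF mfd, of y]
  have "linear (frechet_derivative (\<lambda>e. snd d (R (y, tangent_of A (chart_at A y) y e)))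
      (at (\<eta> (chart_at A y))))" if "d \<in> A" "R (y, \<eta>) \<in> fst d" for d
    using retraction_in_coordinates(2)[OF mfd R c that(1)] tangent_of_coord_inverse[OF c \<eta>] that
    by (intro linear_frechet_derivative) auto
  then show ?thesis
    by (auto simp: diff_retraction_def fiber_derivative_def Let_def fun_eq_iff scaleR_fun_def
        linear_scale)
qed

text \<open>
  The scaling multiplies the differentiated retraction by a factor in \<open>[0, 1]\<close> and caps the norm of
  the result by that of \<open>\<eta>\<close>. Hence the strong curvature condition, which concerns the
  unscaled vector, also holds for the scaled one.
\<close>

lemma scaled_transport_bounds:
  fixes \<alpha> :: real
  assumes g: "riemannian_manifold A g" and R: "manifold_retraction A R"
    and \<eta>: "\<eta> \<in> tangent_space A y"
  defines "z \<equiv> R (y, \<alpha> *\<^sub>R \<eta>)" and "T \<equiv> scaled_transport A g R y \<alpha> \<eta>"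
  shows "T \<in> tangent_space A z"
    and "g z T T \<le> g y \<eta> \<eta>"
    and "u \<in> tangent_space A z \<Longrightarrow>
      \<bar>g z u T\<bar> \<le> \<bar>g z u (diff_retraction A R y (\<alpha> *\<^sub>R \<eta>) \<eta>)\<bar>"
proof -
  have mfd: "smooth_manifold A" using g unfolding riemannian_manifold_def by blast
  define v where "v = diff_retraction A R y (\<alpha> *\<^sub>R \<eta>) \<eta>"
  define s where
    "s = (if metric_norm g z v \<le> metric_norm g y \<eta> then 1 else metric_norm g y \<eta> / metric_norm g z v)"
  have v: "v \<in> tangent_space A z"
    unfolding v_def z_def
    by (rule diff_retraction_mem[OF mfd R subspace_scale[OF subspace_tangent_space[OF mfd] \<eta>]])
  have T: "T = s *\<^sub>R v"
    by (simp add: T_def s_def v_def z_def scaled_transport_def Let_def)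
  have nn: "0 \<le> metric_norm g y \<eta>"
    using metric_nonneg[OF g \<eta>] by (simp add: metric_norm_def)
  have s: "0 \<le> s" "s \<le> 1" using nn by (auto simp: s_def divide_simps)
  show mem: "T \<in> tangent_space A z"
    unfolding T by (rule subspace_scale[OF subspace_tangent_space[OF mfd] v])
  have "s * metric_norm g z v \<le> metric_norm g y \<eta>"
    using nn by (auto simp: s_def)
  moreover have "0 \<le> s * metric_norm g z v"
    using s metric_nonneg[OF g v] by (simp add: metric_norm_def)
  ultimately have "(s * metric_norm g z v)\<^sup>2 \<le> (metric_norm g y \<eta>)\<^sup>2"
    by (intro power_mono) auto
  then have "s\<^sup>2 * g z v v \<le> g y \<eta> \<eta>"
    by (simp add: power_mult_distrib metric_norm_square[OF g v] metric_norm_square[OF g \<eta>])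
  moreover have "g z T T = s\<^sup>2 * g z v v"
    using metric_scale_left[OF g v mem] metric_scale_right[OF g v v]
    by (simp add: T power2_eq_square)
  ultimately show "g z T T \<le> g y \<eta> \<eta>" by simp
  show "\<bar>g z u T\<bar> \<le> \<bar>g z u (diff_retraction A R y (\<alpha> *\<^sub>R \<eta>) \<eta>)\<bar>"
    if "u \<in> tangent_space A z"
    using s metric_scale_right[OF g v that]
    by (simp add: T abs_mult mult_left_le_one_le flip: v_def)
qed


section \<open>Decrease of the objective\<close>

text \<open>
  One step of Zoutendijk's argument. The curvature condition and the Lipschitz property, applied to
  the unit vector along \<open>\<eta>\<close> at parameter \<open>\<alpha> \<parallel>\<eta>\<parallel>\<close>, give
  \<open>(1 - c\<^sub>2) \<bar>m\<bar> \<le> L \<alpha> \<parallel>\<eta>\<parallel>\<^sup>2\<close> for the slope \<open>m\<close>; the Armijo condition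
  converts this lower bound for \<open>\<alpha>\<close> into a decrease of \<open>f\<close>.
\<close>

lemma wolfe_decrease:
  fixes \<alpha> c1 c2 :: real
  assumes g: "riemannian_manifold A g" and R: "manifold_retraction A R"
    and f: "smooth_function A f" and \<eta>: "\<eta> \<in> tangent_space A y"
    and L: "0 < L" "\<And>\<xi> t. \<xi> \<in> tangent_space A y \<Longrightarrow> 0 \<le> t \<Longrightarrow> metric_norm g y \<xi> = 1 \<Longrightarrow>
           \<bar>fiber_derivative A y (\<lambda>v. f (R (y, v))) (t *\<^sub>R \<xi>) \<xi>
             - fiber_derivative A y (\<lambda>v. f (R (y, v))) 0 \<xi>\<bar> \<le> L * t"
    and c: "0 < c1"
    and \<alpha>: "0 < \<alpha>"
    and descent: "g y (grad A g f y) \<eta> < 0"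
    and armijo: "f (R (y, \<alpha> *\<^sub>R \<eta>)) \<le> f y + c1 * \<alpha> * g y (grad A g f y) \<eta>"
    and curvature: "\<bar>g (R (y, \<alpha> *\<^sub>R \<eta>)) (grad A g f (R (y, \<alpha> *\<^sub>R \<eta>)))
               (diff_retraction A R y (\<alpha> *\<^sub>R \<eta>) \<eta>)\<bar>
             \<le> c2 * \<bar>g y (grad A g f y) \<eta>\<bar>"
  shows "0 < g y \<eta> \<eta>"
    and "f (R (y, \<alpha> *\<^sub>R \<eta>)) \<le> f y - c1 * (1 - c2) / L * ((g y (grad A g f y) \<eta>)\<^sup>2 / g y \<eta> \<eta>)"
proof -
  have mfd: "smooth_manifold A" using g unfolding riemannian_manifold_def by blast
  note sub = subspace_tangent_space[OF mfd, of y]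
  let ?z = "R (y, \<alpha> *\<^sub>R \<eta>)"
  define m where "m = g y (grad A g f y) \<eta>"
  define w where "w = g ?z (grad A g f ?z) (diff_retraction A R y (\<alpha> *\<^sub>R \<eta>) \<eta>)"
  define N where "N = g y \<eta> \<eta>"
  define n where "n = metric_norm g y \<eta>"
  define \<xi> where "\<xi> = (1 / n) *\<^sub>R \<eta>"
  have "\<eta> \<noteq> 0"
    using descent metric_scale_right[OF g \<eta> grad_mem[OF g f], of 0] by auto
  then show N_pos: "0 < g y \<eta> \<eta>" by (rule metric_pos[OF g \<eta>])
  then have n: "0 < n" "n * n = N"
    by (simp_all add: n_def N_def metric_norm_def)
  have \<xi>: "\<xi> \<in> tangent_space A y" unfolding \<xi>_def using sub \<eta> by (rule subspace_scale)
  have \<alpha>\<eta>: "\<alpha> *\<^sub>R \<eta> \<in> tangent_space A y" using sub \<eta> by (rule subspace_scale)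
  have "g y \<xi> \<xi> = 1"
    using metric_scale_left[OF g \<eta> \<xi>] metric_scale_right[OF g \<eta> \<eta>] n N_pos
    by (simp add: \<xi>_def N_def)
  then have unit: "metric_norm g y \<xi> = 1" by (simp add: metric_norm_def)
  have t\<xi>: "(\<alpha> * n) *\<^sub>R \<xi> = \<alpha> *\<^sub>R \<eta>" using n by (simp add: \<xi>_def)
  have "fiber_derivative A y (\<lambda>v. f (R (y, v))) ((\<alpha> * n) *\<^sub>R \<xi>) \<xi> = w / n"
    unfolding t\<xi> fiber_derivative_eq_grad[OF g R f \<alpha>\<eta>]
    using metric_scale_right[OF g diff_retraction_mem[OF mfd R \<alpha>\<eta>] grad_mem[OF g f]]
    by (simp add: \<xi>_def w_def diff_retraction_scale[OF mfd R \<alpha>\<eta>])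
  moreover have "fiber_derivative A y (\<lambda>v. f (R (y, v))) 0 \<xi> = m / n"
  proof -
    have "R (y, 0) = y" "diff_retraction A R y 0 \<xi> = \<xi>"
      using R \<xi> unfolding manifold_retraction_def by auto
    then show ?thesis
      using fiber_derivative_eq_grad[OF g R f subspace_0[OF sub], of \<xi>]
        metric_scale_right[OF g \<eta> grad_mem[OF g f]]
      by (simp add: \<xi>_def m_def)
  qed
  ultimately have "\<bar>w / n - m / n\<bar> \<le> L * (\<alpha> * n)"
    using L(2)[OF \<xi> _ unit, of "\<alpha> * n"] \<alpha> n(1) by simp
  then have "(w - m) / n \<le> L * (\<alpha> * n)" by (simp add: diff_divide_distrib)
  then have "w - m \<le> L * \<alpha> * N" using n by (simp add: pos_divide_le_eq mult.assoc)
  moreover have "c2 * m \<le> w" using curvature descent by (simp add: w_def m_def)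
  ultimately have "(1 - c2) * - m \<le> \<alpha> * (L * N)" by (simp add: algebra_simps)
  moreover have "0 < L * N" using L(1) N_pos by (simp add: N_def)
  ultimately have "(1 - c2) * - m / (L * N) \<le> \<alpha>" by (simp only: pos_divide_le_eq)
  then have "c1 * - m * ((1 - c2) * - m / (L * N)) \<le> c1 * - m * \<alpha>"
    using c descent by (intro mult_left_mono) (auto simp: m_def mult_le_0_iff)
  then have "c1 * (1 - c2) / L * (m\<^sup>2 / N) \<le> c1 * \<alpha> * - m"
    by (simp add: power2_eq_square mult_ac)
  then show "f ?z \<le> f y - c1 * (1 - c2) / L * ((g y (grad A g f y) \<eta>)\<^sup>2 / g y \<eta> \<eta>)"
    using armijo by (simp add: m_def N_def)
qed


section \<open>The scalar recursion of the method\<close>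

text \<open>
  The new slope is \<open>- G + \<beta> s = - G / (s - m) * ((1 - r) s - m)\<close>, and \<open>s - m\<close> is positive, so both
  claims follow from \<open>\<bar>r m\<bar> \<le> (1 - r) s - m\<close>. Since \<open>\<bar>s\<bar> \<le> c \<bar>m\<bar>\<close>, this inequality reduces to
  \<open>\<bar>r\<bar> \<le> 1 - (1 - r) c\<close>. For nonnegative \<open>r\<close> that is \<open>(1 - r) (1 - c) \<ge> 0\<close>; for negative \<open>r\<close>
  it is exactly the bound \<open>- r \<le> (1 - c) / (1 + c)\<close>.
\<close>

lemma dai_yuan_ratio_step:
  fixes m s G r c :: real
  assumes m: "m < 0" and s: "\<bar>s\<bar> \<le> c * \<bar>m\<bar>" and c: "0 < c" "c < 1" and G: "0 < G"
    and r: "- ((1 - c) / (1 + c)) \<le> r" "r \<le> 1"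
  defines "\<beta> \<equiv> r * (G / (s - m))"
  shows "- G + \<beta> * s < 0" and "\<beta>\<^sup>2 * m\<^sup>2 \<le> (- G + \<beta> * s)\<^sup>2"
proof -
  have "c * \<bar>m\<bar> < \<bar>m\<bar>" using m c by simp
  then have d: "0 < s - m" using s m by linarith
  have r': "- (1 - c) \<le> r * (1 + c)"
    using r(1) c by (simp add: minus_divide_left pos_divide_le_eq)
  have "(1 - r) * - s \<le> (1 - r) * (c * - m)"
    using r s m by (intro mult_left_mono) auto
  then have low: "(1 - (1 - r) * c) * - m \<le> (1 - r) * s - m" by (simp add: algebra_simps)
  have "\<bar>r\<bar> \<le> 1 - (1 - r) * c"
  proof (cases "0 \<le> r")
    case True
    have "0 \<le> (1 - r) * (1 - c)" using r c by simp
    then show ?thesis using True by (simp add: algebra_simps)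
  next
    case False
    then show ?thesis using r' by (simp add: algebra_simps)
  qed
  then have "\<bar>r\<bar> * - m \<le> (1 - (1 - r) * c) * - m"
    using m by (intro mult_right_mono) auto
  then have key: "\<bar>r * m\<bar> \<le> (1 - r) * s - m" using low m by (simp only: abs_mult abs_of_neg)
  have pos: "0 < (1 - r) * s - m"
    \<comment> \<open>The bound by \<open>\<bar>r m\<bar>\<close> is strict enough unless \<open>r = 0\<close>, where the term is the denominator.\<close>
  proof (cases "r = 0")
    case True
    then show ?thesis using d by simp
  next
    case False
    then have "0 < \<bar>r * m\<bar>" using m by simp
    then show ?thesis using key by linarith
  qed
  have next_m: "- G + \<beta> * s = - (G / (s - m) * ((1 - r) * s - m))"
    using d by (simp add: \<beta>_def field_simps)
  have q: "0 < G / (s - m)" using G d by simp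
  then show "- G + \<beta> * s < 0"
    using mult_pos_pos[OF _ pos] unfolding next_m by (simp only: neg_less_0_iff_less)
  have "\<bar>\<beta> * m\<bar> = G / (s - m) * \<bar>r * m\<bar>" using G by (simp add: \<beta>_def abs_mult abs_of_pos[OF d])
  also have "\<dots> \<le> G / (s - m) * ((1 - r) * s - m)" using key q by (intro mult_left_mono) auto
  also have "\<dots> = \<bar>- G + \<beta> * s\<bar>"
    using mult_pos_pos[OF q pos] unfolding next_m by (simp only: abs_minus_cancel abs_of_pos)
  finally have "\<bar>\<beta> * m\<bar> \<le> \<bar>- G + \<beta> * s\<bar>" .
  then have "(\<beta> * m)\<^sup>2 \<le> (- G + \<beta> * s)\<^sup>2" by (simp only: abs_le_square_iff)
  then show "\<beta>\<^sup>2 * m\<^sup>2 \<le> (- G + \<beta> * s)\<^sup>2" by (simp add: power_mult_distrib)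
qed

text \<open>
  After division by \<open>m'\<^sup>2\<close> the remainder \<open>- 2 m' - G\<close> contributes at most \<open>1 / G\<close>, because
  \<open>m'\<^sup>2 + 2 m' G + G\<^sup>2\<close> is the square of \<open>m' + G\<close>.
\<close>

lemma inverse_square_cosine_step:
  fixes m m' N N' G \<beta> :: real
  assumes "m < 0" "m' < 0" "0 < G" "0 \<le> N"
    and N': "N' \<le> \<beta>\<^sup>2 * N - 2 * m' - G" and \<beta>: "\<beta>\<^sup>2 * m\<^sup>2 \<le> m'\<^sup>2"
  shows "N' / m'\<^sup>2 \<le> N / m\<^sup>2 + 1 / G"
proof -
  have pos: "0 < m\<^sup>2" "0 < m'\<^sup>2" using assms by simp_all
  have "0 \<le> (m' + G)\<^sup>2" by simp
  then have "(- 2 * m' - G) * G \<le> m'\<^sup>2" by (simp add: power2_eq_square algebra_simps)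
  then have "- 2 * m' - G \<le> m'\<^sup>2 / G" using \<open>0 < G\<close> by (simp add: pos_le_divide_eq)
  moreover have "\<beta>\<^sup>2 * N \<le> m'\<^sup>2 * (N / m\<^sup>2)"
  proof -
    have "\<beta>\<^sup>2 * N = (\<beta>\<^sup>2 * m\<^sup>2) * (N / m\<^sup>2)" using pos by simp
    also have "\<dots> \<le> m'\<^sup>2 * (N / m\<^sup>2)" using \<beta> \<open>0 \<le> N\<close> pos by (intro mult_right_mono) auto
    finally show ?thesis .
  qed
  ultimately have "N' \<le> m'\<^sup>2 * (N / m\<^sup>2) + m'\<^sup>2 / G" using N' by linarith
  also have "\<dots> = (N / m\<^sup>2 + 1 / G) * m'\<^sup>2" by (simp add: algebra_simps)
  finally show ?thesis using pos by (simp add: pos_divide_le_eq)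
qed

text \<open>
  If \<open>G\<close> stayed above \<open>\<delta>\<close> from \<open>K\<close> on, then \<open>a\<close> would grow at most linearly, while the total
  decrease of \<open>F\<close> bounds the sum of the reciprocals of \<open>a\<close>: this contradicts the divergence of the
  harmonic series.
\<close>

lemma linear_growth_contradicts_bounded_decrease:
  fixes a G F :: "nat \<Rightarrow> real"
  assumes a: "\<And>k. 0 < a k" and C: "0 < C"
    and decrease: "\<And>k. F (Suc k) \<le> F k - C * (1 / a k)" and bounded: "\<And>k. b \<le> F k"
    and growth: "\<And>k. a (Suc k) \<le> a k + 1 / G (Suc k)" and \<delta>: "0 < \<delta>"
  shows "\<exists>k\<ge>K. G k < \<delta>"
proof (rule ccontr)
  assume "\<not> ?thesis"
  then have G: "\<delta> \<le> G k" if "K \<le> k" for k using that by (meson not_less)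
  define P where "P = max (a K) (1 / \<delta>)"
  have P: "0 < P" "a K \<le> P" "1 / \<delta> \<le> P" using a[of K] by (auto simp: P_def less_max_iff_disj)
  have lin: "a (K + j) \<le> P * real (Suc j)" for j
  proof (induction j)
    case 0
    then show ?case using P by simp
  next
    case (Suc j)
    have "1 / G (Suc (K + j)) \<le> 1 / \<delta>" using G[of "Suc (K + j)"] \<delta> by (intro divide_left_mono) auto
    then show ?case using Suc growth[of "K + j"] P(3) by (simp add: algebra_simps)
  qed
  have harmonic_le: "inverse (real (Suc j)) \<le> P / C * (C * (1 / a (K + j)))" for j
    using lin[of j] a[of "K + j"] C by (simp add: field_simps)
  have total: "(\<Sum>j<n. C * (1 / a (K + j))) \<le> F K - b" for n
  proof -
    have "(\<Sum>j<n. C * (1 / a (K + j))) \<le> F K - F (K + n)"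
    proof (induction n)
      case (Suc n)
      then show ?case using decrease[of "K + n"] by simp
    qed simp
    then show ?thesis using bounded[of "K + n"] by linarith
  qed
  have "(\<Sum>j<n. inverse (real (Suc j))) \<le> P / C * (F K - b)" for n
  proof -
    have "(\<Sum>j<n. inverse (real (Suc j))) \<le> P / C * (\<Sum>j<n. C * (1 / a (K + j)))"
      unfolding sum_distrib_left by (intro sum_mono harmonic_le)
    also have "\<dots> \<le> P / C * (F K - b)" using P C by (intro mult_left_mono total) auto
    finally show ?thesis .
  qed
  then have "summable (\<lambda>j. inverse (real (Suc j)))"
    by (intro summableI_nonneg_bounded) auto
  then show False
    using not_summable_harmonic[where ?'a = real]
      summable_Suc_iff[of "\<lambda>n. inverse (real n)"] by simp
qed


section \<open>Convergence\<close>

theorem theorem3p2: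
  fixes A :: "('m::{t2_space,second_countable_topology}, 'e::real_normed_vector) chart set"
    and g :: "'m \<Rightarrow> ('m, 'e) tangent \<Rightarrow> ('m, 'e) tangent \<Rightarrow> real"
    and R :: "'m \<times> ('m, 'e) tangent \<Rightarrow> 'm"
    and f :: "'m \<Rightarrow> real"
    and c1 c2 \<sigma> :: real
    and x :: "nat \<Rightarrow> 'm"
    and \<eta> :: "nat \<Rightarrow> ('m, 'e) tangent"
    and \<alpha> \<beta> :: "nat \<Rightarrow> real"
  assumes "riemannian_manifold A g"
    and "manifold_retraction A R"
    and "smooth_function A f"
    and "bdd_below (range f)"
    and "\<exists>L>0. \<forall>y. \<forall>\<xi>\<in>tangent_space A y. \<forall>t\<ge>0. metric_norm g y \<xi> = 1 \<longrightarrow>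
           \<bar>fiber_derivative A y (\<lambda>v. f (R (y, v))) (t *\<^sub>R \<xi>) \<xi>
             - fiber_derivative A y (\<lambda>v. f (R (y, v))) 0 \<xi>\<bar> \<le> L * t"
    and "0 < c1" and "c1 < c2" and "c2 < 1"
    and "\<sigma> = (1 - c2) / (1 + c2)"
    and "\<eta> 0 = - grad A g f (x 0)"
    and "\<And>k. grad A g f (x k) \<noteq> 0 \<Longrightarrow> x (Suc k) = R (x k, \<alpha> k *\<^sub>R \<eta> k)"
    and "\<And>k. grad A g f (x k) \<noteq> 0 \<Longrightarrow>
           \<eta> (Suc k) = - grad A g f (x (Suc k))
             + \<beta> (Suc k) *\<^sub>R scaled_transport A g R (x k) (\<alpha> k) (\<eta> k)"
    and "\<And>k0 k. grad A g f (x k0) = 0 \<Longrightarrow> k0 \<le> k \<Longrightarrow> x k = x k0"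
    and "\<And>k. grad A g f (x k) \<noteq> 0 \<Longrightarrow> 0 < \<alpha> k"
    and "\<And>k. grad A g f (x k) \<noteq> 0 \<Longrightarrow>
           f (R (x k, \<alpha> k *\<^sub>R \<eta> k)) \<le> f (x k) + c1 * \<alpha> k * g (x k) (grad A g f (x k)) (\<eta> k)"
    and "\<And>k. grad A g f (x k) \<noteq> 0 \<Longrightarrow>
           \<bar>g (R (x k, \<alpha> k *\<^sub>R \<eta> k)) (grad A g f (R (x k, \<alpha> k *\<^sub>R \<eta> k)))
               (diff_retraction A R (x k) (\<alpha> k *\<^sub>R \<eta> k) (\<eta> k))\<bar>
             \<le> c2 * \<bar>g (x k) (grad A g f (x k)) (\<eta> k)\<bar>"
    and "\<And>k. 1 \<le> k \<Longrightarrow> grad A g f (x k) \<noteq> 0 \<Longrightarrow>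
           - \<sigma> \<le> \<beta> k / beta_DY A g R f x \<alpha> \<eta> k \<and> \<beta> k / beta_DY A g R f x \<alpha> \<eta> k \<le> 1"
  shows "liminf (\<lambda>k. ereal (metric_norm g (x k) (grad A g f (x k)))) = 0"
proof (cases "\<exists>k0. grad A g f (x k0) = 0")
  case True
  then obtain k0 where k0: "grad A g f (x k0) = 0" by blast
  have mfd: "smooth_manifold A" using assms(1) unfolding riemannian_manifold_def by blast
  note zero = subspace_0[OF subspace_tangent_space[OF mfd], of "x k0"]
  have "metric_norm g (x k0) 0 = 0"
    using metric_scale_left[OF assms(1) zero zero, of 0] by (simp add: metric_norm_def)
  then have "ereal (metric_norm g (x k) (grad A g f (x k))) = 0" if "k0 \<le> k" for k
    using assms(13)[OF k0 that] k0 by simp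
  then have "eventually (\<lambda>k. ereal (metric_norm g (x k) (grad A g f (x k))) = 0) sequentially"
    by (auto simp: eventually_sequentially)
  from Liminf_eq[OF this] show ?thesis by (simp add: Liminf_const)
next
  case False
  then have nz: "grad A g f (x k) \<noteq> 0" for k by blast
  note g = assms(1) and R = assms(2) and f = assms(3)
  note step = assms(11)[OF nz] and dir = assms(12)[OF nz] and \<alpha>_pos = assms(14)[OF nz]
    and armijo = assms(15)[OF nz] and curvature = assms(16)[OF nz]
  have mfd: "smooth_manifold A" using g unfolding riemannian_manifold_def by blast
  note sub = subspace_tangent_space[OF mfd]
  obtain L where L: "0 < L" "\<And>y \<xi> t. \<xi> \<in> tangent_space A y \<Longrightarrow> 0 \<le> t \<Longrightarrow>
      metric_norm g y \<xi> = 1 \<Longrightarrow>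
      \<bar>fiber_derivative A y (\<lambda>v. f (R (y, v))) (t *\<^sub>R \<xi>) \<xi>
        - fiber_derivative A y (\<lambda>v. f (R (y, v))) 0 \<xi>\<bar> \<le> L * t"
    using assms(5) by blast
  have c: "0 < c1" "0 < c2" "c2 < 1" using assms(6-8) by auto
  define d where "d k = grad A g f (x k)" for k
  define m where "m k = g (x k) (d k) (\<eta> k)" for k
  define N where "N k = g (x k) (\<eta> k) (\<eta> k)" for k
  define G where "G k = g (x k) (d k) (d k)" for k
  define T where "T k = scaled_transport A g R (x k) (\<alpha> k) (\<eta> k)" for k
  define s where "s k = g (x (Suc k)) (d (Suc k)) (T k)" for k
  have d: "d k \<in> tangent_space A (x k)" for k unfolding d_def by (rule grad_mem[OF g f])
  have G_pos: "0 < G k" for k unfolding G_def using nz by (intro metric_pos[OF g d]) (simp add: d_def)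
  have G_norm: "(metric_norm g (x k) (grad A g f (x k)))\<^sup>2 = G k" for k
    using metric_norm_square[OF g d] by (simp add: G_def d_def)
  \<comment> \<open>The minus sign is written as a scalar so that the metric rules for multiples apply.\<close>
  have \<eta>_Suc: "\<eta> (Suc k) = (-1) *\<^sub>R d (Suc k) + \<beta> (Suc k) *\<^sub>R T k" for k
    using dir by (simp add: d_def T_def)
  have T: "T k \<in> tangent_space A (x (Suc k))" "g (x (Suc k)) (T k) (T k) \<le> N k"
    "\<bar>s k\<bar> \<le> c2 * \<bar>m k\<bar>" if "\<eta> k \<in> tangent_space A (x k)" for k
    using scaled_transport_bounds[OF g R that, where \<alpha> = "\<alpha> k"] curvature[of k] d[of "Suc k"]
    by (fastforce simp: T_def N_def m_def s_def d_def step)+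
  have \<eta>: "\<eta> k \<in> tangent_space A (x k)" for k
  proof (induction k)
    case 0
    then show ?case using subspace_neg[OF sub d[of 0]] unfolding d_def assms(10) .
  next
    case (Suc k)
    show ?case unfolding \<eta>_Suc by (intro subspace_add[OF sub] subspace_scale[OF sub] d T Suc)
  qed
  note T = T[OF \<eta>]
  have m_Suc: "m (Suc k) = - G (Suc k) + \<beta> (Suc k) * s k" for k
    unfolding m_def \<eta>_Suc
      metric_add_right[OF g subspace_scale[OF sub d] d subspace_scale[OF sub T(1)]]
      metric_scale_right[OF g d d] metric_scale_right[OF g T(1) d]
    by (simp add: G_def s_def)
  have N_Suc: "N (Suc k) \<le> (\<beta> (Suc k))\<^sup>2 * N k - 2 * m (Suc k) - G (Suc k)" for k
  proof -
    let ?y = "x (Suc k)" and ?b = "\<beta> (Suc k)"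
    have bT: "?b *\<^sub>R T k = \<eta> (Suc k) + d (Suc k)" by (simp add: \<eta>_Suc)
    have "?b\<^sup>2 * g ?y (T k) (T k) = g ?y (?b *\<^sub>R T k) (?b *\<^sub>R T k)"
      using metric_scale_left[OF g T(1) subspace_scale[OF sub T(1)]] metric_scale_right[OF g T(1) T(1)]
      by (simp add: power2_eq_square)
    also have "\<dots> = N (Suc k) + 2 * m (Suc k) + G (Suc k)"
      unfolding bT
      by (simp add: metric_add_right[OF g \<eta>] metric_add_left[OF g \<eta>] subspace_add[OF sub] d \<eta>
          N_def m_def G_def metric_commute[OF g \<eta> d])
    finally show ?thesis using mult_left_mono[OF T(2), of "?b\<^sup>2" k] by simp
  qed
  have step_bounds: "m (Suc k) < 0 \<and> (\<beta> (Suc k))\<^sup>2 * (m k)\<^sup>2 \<le> (m (Suc k))\<^sup>2" if "m k < 0" for k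
  proof -
    define r where "r = \<beta> (Suc k) / (G (Suc k) / (s k - m k))"
    have DY: "beta_DY A g R f x \<alpha> \<eta> (Suc k) = G (Suc k) / (s k - m k)"
      by (simp add: beta_DY_def G_norm s_def m_def d_def T_def)
    have r: "- ((1 - c2) / (1 + c2)) \<le> r" "r \<le> 1"
      using assms(17)[of "Suc k"] nz assms(9) by (simp_all add: r_def DY)
    have "c2 * \<bar>m k\<bar> < \<bar>m k\<bar>" using that c by simp
    then have "s k - m k > 0" using T(3)[of k] that by linarith
    then have "\<beta> (Suc k) = r * (G (Suc k) / (s k - m k))" using G_pos[of "Suc k"] by (simp add: r_def)
    then show ?thesis
      using dai_yuan_ratio_step[OF that T(3) c(2,3) G_pos r, of "Suc k"] by (simp add: m_Suc)
  qed
  have m: "m k < 0" for k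
  proof (induction k)
    case 0
    have "m 0 = - G 0"
      using metric_scale_right[OF g d d, of 0 "-1"] assms(10) by (simp add: m_def G_def d_def)
    then show ?case using G_pos[of 0] by simp
  qed (use step_bounds in blast)
  have descent: "g (x k) (grad A g f (x k)) (\<eta> k) < 0" for k
    using m by (simp add: m_def d_def)
  have N_pos: "0 < N k"
    and dec: "f (x (Suc k)) \<le> f (x k) - c1 * (1 - c2) / L * ((m k)\<^sup>2 / N k)" for k
    using wolfe_decrease[OF g R f \<eta>[of k] L c(1) \<alpha>_pos[of k] descent armijo curvature]
    unfolding m_def N_def d_def step by blast+
  obtain b where b: "b \<le> f y" for y using assms(4) by (auto simp: bdd_below_def)
  have small: "\<exists>k\<ge>K. G k < \<delta>" if "0 < \<delta>" for \<delta> K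
  proof (rule linear_growth_contradicts_bounded_decrease)
    show "0 < N k / (m k)\<^sup>2" for k using N_pos[of k] m[of k] by simp
    show "0 < c1 * (1 - c2) / L" using c L(1) by simp
    show "f (x (Suc k)) \<le> f (x k) - c1 * (1 - c2) / L * (1 / (N k / (m k)\<^sup>2))" for k
      using dec[of k] by simp
    show "b \<le> f (x k)" for k by (rule b)
    show "N (Suc k) / (m (Suc k))\<^sup>2 \<le> N k / (m k)\<^sup>2 + 1 / G (Suc k)" for k
      by (rule inverse_square_cosine_step[OF m m G_pos less_imp_le[OF N_pos] N_Suc])
        (use step_bounds m in blast)
  qed (rule that)
  show ?thesis
  proof (rule antisym)
    show "liminf (\<lambda>k. ereal (metric_norm g (x k) (grad A g f (x k)))) \<le> 0"
    proof (rule ccontr)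
      assume "\<not> ?thesis"
      then have "0 < liminf (\<lambda>k. ereal (metric_norm g (x k) (grad A g f (x k))))" by simp
      then obtain e where e: "0 < ereal e"
        "ereal e < liminf (\<lambda>k. ereal (metric_norm g (x k) (grad A g f (x k))))"
        using ereal_dense2 by blast
      from less_LiminfD[OF e(2)]
      obtain K where K: "\<And>k. K \<le> k \<Longrightarrow> e < metric_norm g (x k) (grad A g f (x k))"
        by (auto simp: eventually_sequentially)
      obtain k where k: "K \<le> k" "G k < e\<^sup>2" using small[of "e\<^sup>2" K] e(1) by auto
      have "e\<^sup>2 \<le> G k" unfolding G_norm[symmetric] using K[OF k(1)] e(1) by (intro power_mono) auto
      then show False using k(2) by simp
    qed
    show "0 \<le> liminf (\<lambda>k. ereal (metric_norm g (x k) (grad A g f (x k))))"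
      using metric_nonneg[OF g d]
      by (intro Liminf_bounded always_eventually) (simp add: metric_norm_def d_def)
  qed
qed

end
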